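(* Let $m\geq n\geq1$ be integers, $k\in\mathbb{C}$, $\alpha_1=k+n$, $\alpha_2=k+m$, and let $W^{(1)}_{p,q},W^{(2)}_{i,j}\in\mathcal{W}^k(\mathfrak{gl}(m+n),f)$ be the elements of the context. Let $(p,q)$ satisfy $1\leq p\leq m-n,\ 1\leq q\leq m$, or $m-n<p,q\leq m$, and let $m-n<i\leq m$, $1\leq j\leq m$. Then (summation indices are $\geq1$): $$\begin{aligned}(W^{(1)}_{p,q})_{(0)}W^{(2)}_{i,j}&=-\delta_{p,j}W^{(2)}_{i,q}+\delta_{i,q}\delta(p>m-n)W^{(2)}_{p,j}-\delta_{i,q}\delta(p\leq m-n)\sum_{w\leq m-n}(W^{(1)}_{w,j})_{(-1)}W^{(1)}_{p,w}\\&\quad-\delta_{i,q}\delta(p\leq m-n)\alpha_2\partial W^{(1)}_{p,j}+\delta(p\leq m-n,\ q>m-n)(W^{(1)}_{p,j})_{(-1)}W^{(1)}_{i,q},\end{aligned}$$ $$\begin{aligned}(W^{(1)}_{p,q})_{(1)}W^{(2)}_{i,j}&=\delta_{p,j}\alpha_1\delta(q>m-n)W^{(1)}_{i,q}-\delta_{i,q}\delta(p\leq m-n)(\alpha_2+\alpha_1)W^{(1)}_{p,j}\\&\quad+\delta_{p,q}\delta(j>m-n)W^{(1)}_{i,j}-\delta_{i,j}\delta(q\leq m-n)W^{(1)}_{p,q}+\delta_{p,j}\delta_{q,i}\sum_{w\leq m-n}W^{(1)}_{w,w},\end{aligned}$$ $$(W^{(1)}_{p,q})_{(2)}W^{(2)}_{i,j}=-\delta_{q,i}\delta_{p,j}(\alpha_1+\alpha_2)\alpha_1|0\rangle-\delta_{p,q}\delta_{i,j}\bigl(\delta(p,q\leq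 m-n)\alpha_1+2\alpha_2\bigr)|0\rangle,$$ $$(W^{(1)}_{p,q})_{(s)}W^{(2)}_{i,j}=0\quad\text{for all }s>2.$$
   Context: $\delta(P)$ is $1$ if the condition $P$ holds and $0$ otherwise (a term with vanishing delta factor is $0$, even if the symbol it multiplies is undefined). $u_{(s)}v$ denotes the $s$-th product of a vertex algebra, $|0\rangle$ the vacuum and $\partial$ the translation operator. Let $e_{i,j}$ ($1\leq i,j\leq m+n$) be the matrix units of $\mathfrak{gl}(m+n)$. Put $\mathrm{col}(i)=1,\ \mathrm{row}(i)=i$ if $i\leq m$, and $\mathrm{col}(i)=2,\ \mathrm{row}(i)=i-n$ if $i>m$. For $m-n<i\leq m$ put $\hat i=i+n$; for $m<j\leq m+n$ put $\tilde j=j-n$. The nilpotent element is $f=\sum_{m-n<j\leq m}e_{\hat j,j}$, of type $(2^n,1^{m-n})$. Let $\mathfrak{b}=\bigoplus_{\mathrm{col}(i)\geq\mathrm{col}(j)}\mathbb{C}e_{i,j}$, with bilinear form $\kappa(e_{i,j},e_{p,q})=\alpha_1\delta_{i,q}\delta_{p,j}+\delta_{i,j}\delta_{p,q}$ if $1\leq i,j,p,q\leq m$; $=\alpha_2\delta_{i,q}\delta_{p,j}+\delta_{i,j}\delta_{p,q}$ if $m<i,j,p,q\leq m+n$; $=0$ otherwise. Let $\mathfrak{a}=\mathfrak{b}\oplus\bigoplus_{\mathrm{col}(i)>\mathrm{col}(j)}\mathbb{C}\psi_{i,j}$ be the Lie superalgebra with $\mathfrak b$ even, $\psi_{i,j}$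 odd, $[e_{i,j},\psi_{p,q}]=\delta_{j,p}\psi_{i,q}-\delta_{i,q}\psi_{p,j}$, $[\psi_{i,j},\psi_{p,q}]=0$ (symbols $\psi$ with out-of-range indices are $0$), and extend $\kappa$ to $\tilde\kappa$ on $\mathfrak a$ by zero on all pairs involving a $\psi$. $V^\kappa(\mathfrak b)\subset V^{\tilde\kappa}(\mathfrak a)$ are the universal affine vertex (super)algebras, identified with $U(t^{-1}\mathfrak b[t^{-1}])$ and $U(t^{-1}\mathfrak a[t^{-1}])$; $u[-s]$ denotes $ut^{-s}$; products of such elements denote $(-1)$-products; the OPE is $u(z)v(w)\sim\frac{[u,v](w)}{z-w}+\frac{\tilde\kappa(u,v)}{(z-w)^2}$. Let $d_0\colon V^\kappa(\mathfrak b)\to V^{\tilde\kappa}(\mathfrak a)$ be the odd derivation (with respect to all $n$-th products) with $d_0|0\rangle=0$, $[d_0,\partial]=0$ and $$d_0(e_{i,j}[-1])=\sum_{\mathrm{col}(i)>\mathrm{col}(r)\geq\mathrm{col}(j)}e_{r,j}[-1]\psi_{i,r}[-1]-\sum_{\mathrm{col}(j)<\mathrm{col}(r)\leq\mathrm{col}(i)}\psi_{r,j}[-1]e_{i,r}[-1]+\delta(\mathrm{col}(i)>\mathrm{col}(j))\alpha_2\psi_{i,j}[-2]+\psi_{\hat i,j}[-1]-\psi_{i,\tilde j}[-1],$$ where terms with $\hat i$ or $\tilde j$ not defined are $0$. The $W$-algebra is the vertex subalgebra $\mathcal{W}^k(\mathfrak{gl}(m+n),f)=\{y\in V^\kappa(\mathfrak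 b)\mid d_0(y)=0\}$. It contains the elements $$W^{(1)}_{i,j}=\sum_{\substack{\mathrm{row}(h)=i,\ \mathrm{row}(l)=j\\ \mathrm{col}(h)=\mathrm{col}(l)}}e_{h,l}[-1]\quad(1\leq i\leq m-n,\ 1\leq j\leq m,\ \text{or } m-n<i,j\leq m),$$ $$W^{(2)}_{i,j}=e_{\hat i,j}[-1]-\alpha_2e_{i,j}[-2]+\sum_{m-n<u\leq m}e_{u,j}[-1]e_{\hat i,\hat u}[-1]-\sum_{1\leq u\leq m-n}e_{u,j}[-1]e_{i,u}[-1]\quad(m-n<i\leq m,\ 1\leq j\leq m).$$ *)

theory Defs
  imports Complex_Main "HOL-Library.Poly_Mapping"
begin

section \<open>Vertex superalgebras\<close>

text \<open>
  The complex vector space underlying a vertex superalgebra is a subspace \<open>vspace\<close> of the type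
  \<open>'v\<close> with scalar multiplication \<open>vscale\<close>; \<open>vpart False\<close> and \<open>vpart True\<close> are its even and odd
  parts, and \<open>nprod V u s v\<close> is the \<open>s\<close>-th product.
\<close>

record 'v vsalg =
  vspace :: "'v set"
  vpart  :: "bool \<Rightarrow> 'v set"
  vscale :: "complex \<Rightarrow> 'v \<Rightarrow> 'v"
  vac    :: 'v
  transl :: "'v \<Rightarrow> 'v"
  nprod  :: "'v \<Rightarrow> int \<Rightarrow> 'v \<Rightarrow> 'v"

definition ksign :: "bool \<Rightarrow> bool \<Rightarrow> complex" where
  "ksign a b = (if a \<and> b then -1 else 1)"

text \<open>
  The sums in the Borcherds identity are over all \<open>l :: nat\<close>; truncation makes them finite, so
  \<^const>\<open>Sum_any\<close> gives them their intended value.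
\<close>

locale vertex_superalgebra =
  fixes V :: "'v::ab_group_add vsalg"
  assumes vector_space: "vector_space (vscale V)"
    and subspace_part: "module.subspace (vscale V) (vpart V a)"
    and part_disjoint: "vpart V False \<inter> vpart V True = {0}"
    and space_eq: "vspace V = {u + v |u v. u \<in> vpart V False \<and> v \<in> vpart V True}"
    and vac_even: "vac V \<in> vpart V False"
    and nprod_part: "u \<in> vpart V a \<Longrightarrow> v \<in> vpart V b \<Longrightarrow> nprod V u s v \<in> vpart V (a \<noteq> b)"
    and nprod_add_left: "u \<in> vspace V \<Longrightarrow> u' \<in> vspace V \<Longrightarrow> v \<in> vspace V \<Longrightarrow>
          nprod V (u + u') s v = nprod V u s v + nprod V u' s v"
    and nprod_add_right: "u \<in> vspace V \<Longrightarrow> v \<in> vspace V \<Longrightarrow> v' \<in> vspace V \<Longrightarrow>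
          nprod V u s (v + v') = nprod V u s v + nprod V u s v'"
    and nprod_scale_left: "u \<in> vspace V \<Longrightarrow> v \<in> vspace V \<Longrightarrow>
          nprod V (vscale V c u) s v = vscale V c (nprod V u s v)"
    and nprod_scale_right: "u \<in> vspace V \<Longrightarrow> v \<in> vspace V \<Longrightarrow>
          nprod V u s (vscale V c v) = vscale V c (nprod V u s v)"
    and truncation: "u \<in> vspace V \<Longrightarrow> v \<in> vspace V \<Longrightarrow> \<exists>N. \<forall>s\<ge>N. nprod V u s v = 0"
    and vacuum: "v \<in> vspace V \<Longrightarrow> nprod V (vac V) s v = (if s = -1 then v else 0)"
    and creation: "v \<in> vspace V \<Longrightarrow> nprod V v (-1) (vac V) = v"
      "v \<in> vspace V \<Longrightarrow> s \<ge> 0 \<Longrightarrow> nprod V v s (vac V) = 0"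
    and translation: "v \<in> vspace V \<Longrightarrow> transl V v = nprod V v (-2) (vac V)"
    and borcherds: "u \<in> vpart V a \<Longrightarrow> v \<in> vpart V b \<Longrightarrow> w \<in> vspace V \<Longrightarrow>
          Sum_any (\<lambda>l::nat. vscale V ((of_int p :: complex) gchoose l)
            (nprod V (nprod V u (r + int l) v) (p + q - int l) w)) =
          Sum_any (\<lambda>l::nat. vscale V ((-1) ^ l * ((of_int r :: complex) gchoose l))
            (nprod V u (p + r - int l) (nprod V v (q + int l) w)
             - vscale V ((-1) powi r * ksign a b)
                 (nprod V v (q + r - int l) (nprod V u (p + int l) w))))"

text \<open>The structure on a subset of the space with all operations inherited.\<close>

definition sub_vsalg :: "'v vsalg \<Rightarrow> 'v set \<Rightarrow> 'v vsalg" where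
  "sub_vsalg V S = V\<lparr>vspace := vspace V \<inter> S, vpart := (\<lambda>a. vpart V a \<inter> S)\<rparr>"


section \<open>Universal affine vertex superalgebras\<close>

text \<open>
  A Lie superalgebra given by a homogeneous basis (with \<open>odd_elt x\<close> saying that \<open>x\<close> is odd), the
  superbrackets of basis elements as linear combinations of basis elements, and the values of a
  bilinear form on basis elements.
\<close>

record 'x lsalg =
  basis   :: "'x set"
  odd_elt :: "'x \<Rightarrow> bool"
  bracket :: "'x \<Rightarrow> 'x \<Rightarrow> 'x \<Rightarrow>\<^sub>0 complex"
  bform   :: "'x \<Rightarrow> 'x \<Rightarrow> complex"

text \<open>The linear extension of a map defined on a basis.\<close>

definition lin_ext :: "'v::ab_group_add vsalg \<Rightarrow> ('x \<Rightarrow> 'v) \<Rightarrow> ('x \<Rightarrow>\<^sub>0 complex) \<Rightarrow> 'v" where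
  "lin_ext V f c = (\<Sum>x\<in>Poly_Mapping.keys c. vscale V (Poly_Mapping.lookup c x) (f x))"

text \<open>
  The pair \<open>(x, s)\<close> with \<open>s \<ge> 1\<close> encodes \<open>x[-s] = x t\<^sup>-\<^sup>s\<close>, and the list \<open>[(x\<^sub>1, s\<^sub>1), \<dots>, (x\<^sub>r, s\<^sub>r)]\<close>
  encodes the word \<open>x\<^sub>1[-s\<^sub>1] \<cdots> x\<^sub>r[-s\<^sub>r]\<close>.
\<close>

definition neg_words :: "'x set \<Rightarrow> ('x \<times> nat) list set" where
  "neg_words B = {w. \<forall>(x, s)\<in>set w. x \<in> B \<and> 1 \<le> s}"

text \<open>
  The two-sided ideal of the free algebra on the \<open>x[-s]\<close> whose quotient is the enveloping algebra
  \<open>U(t\<^sup>-\<^sup>1\<gg>[t\<^sup>-\<^sup>1])\<close>.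
\<close>

definition env_relation :: "'x lsalg \<Rightarrow> ('x \<times> nat) list \<Rightarrow> 'x \<times> nat \<Rightarrow> 'x \<times> nat \<Rightarrow>
    ('x \<times> nat) list \<Rightarrow> ('x \<times> nat) list \<Rightarrow>\<^sub>0 complex" where
  "env_relation L u a b w =
     Poly_Mapping.single (u @ a # b # w) 1
     - Poly_Mapping.single (u @ b # a # w) (ksign (odd_elt L (fst a)) (odd_elt L (fst b)))
     - (\<Sum>z\<in>Poly_Mapping.keys (bracket L (fst a) (fst b)).
          Poly_Mapping.single (u @ (z, snd a + snd b) # w)
            (Poly_Mapping.lookup (bracket L (fst a) (fst b)) z))"

definition env_ideal :: "'x lsalg \<Rightarrow> (('x \<times> nat) list \<Rightarrow>\<^sub>0 complex) set" where
  "env_ideal L = module.span (\<lambda>c. Poly_Mapping.map ((*) c))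
     {env_relation L u a b w |u a b w. u @ a # b # w \<in> neg_words (basis L)}"

text \<open>The image \<open>x\<^sub>1[-s\<^sub>1] \<cdots> x\<^sub>r[-s\<^sub>r]|0\<rangle>\<close> of a word in a vertex superalgebra with currents \<open>J x\<close>.\<close>

definition word_vec :: "'v vsalg \<Rightarrow> ('x \<Rightarrow> 'v) \<Rightarrow> ('x \<times> nat) list \<Rightarrow> 'v" where
  "word_vec V J w = foldr (\<lambda>(x, s) v. nprod V (J x) (- int s) v) w (vac V)"

text \<open>
  \<open>V\<close> is the universal affine vertex superalgebra of \<open>L\<close> with currents \<open>J\<close>: the currents have the
  prescribed operator product expansions, and sending a word to its image in \<open>V\<close> induces a linear
  isomorphism from \<open>U(t\<^sup>-\<^sup>1\<gg>[t\<^sup>-\<^sup>1])\<close> onto \<open>V\<close>. These conditions determine \<open>(V, J)\<close> up to a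
  unique isomorphism.
\<close>

locale universal_affine = vertex_superalgebra V for V :: "'v::ab_group_add vsalg" +
  fixes L :: "'x lsalg" and J :: "'x \<Rightarrow> 'v"
  assumes current_part: "x \<in> basis L \<Longrightarrow> J x \<in> vpart V (odd_elt L x)"
    and ope_0: "x \<in> basis L \<Longrightarrow> y \<in> basis L \<Longrightarrow>
          nprod V (J x) 0 (J y) = lin_ext V J (bracket L x y)"
    and ope_1: "x \<in> basis L \<Longrightarrow> y \<in> basis L \<Longrightarrow>
          nprod V (J x) 1 (J y) = vscale V (bform L x y) (vac V)"
    and ope_ge_2: "x \<in> basis L \<Longrightarrow> y \<in> basis L \<Longrightarrow> s \<ge> 2 \<Longrightarrow> nprod V (J x) s (J y) = 0"
    and words_span: "vspace V = module.span (vscale V) (word_vec V J ` neg_words (basis L))"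
    and words_free: "Poly_Mapping.keys c \<subseteq> neg_words (basis L) \<Longrightarrow>
          lin_ext V (word_vec V J) c = 0 \<longleftrightarrow> c \<in> env_ideal L"


section \<open>The Lie superalgebra \<open>\<aa>\<close>\<close>

datatype gen = E nat nat | Psi nat nat

definition col :: "nat \<Rightarrow> nat \<Rightarrow> nat" where
  "col m i = (if i \<le> m then 1 else 2)"

definition row :: "nat \<Rightarrow> nat \<Rightarrow> nat \<Rightarrow> nat" where
  "row m n i = (if i \<le> m then i else i - n)"

definition b_basis :: "nat \<Rightarrow> nat \<Rightarrow> gen set" where
  "b_basis m n = {E i j |i j. i \<in> {1..m+n} \<and> j \<in> {1..m+n} \<and> col m i \<ge> col m j}"

definition a_basis :: "nat \<Rightarrow> nat \<Rightarrow> gen set" where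
  "a_basis m n = b_basis m n \<union>
     {Psi i j |i j. i \<in> {1..m+n} \<and> j \<in> {1..m+n} \<and> col m i > col m j}"

fun is_Psi :: "gen \<Rightarrow> bool" where
  "is_Psi (E i j) = False"
| "is_Psi (Psi i j) = True"

fun a_bracket :: "gen \<Rightarrow> gen \<Rightarrow> gen \<Rightarrow>\<^sub>0 complex" where
  "a_bracket (E i j) (E p q) =
     Poly_Mapping.single (E i q) (of_bool (j = p)) - Poly_Mapping.single (E p j) (of_bool (i = q))"
| "a_bracket (E i j) (Psi p q) =
     Poly_Mapping.single (Psi i q) (of_bool (j = p)) - Poly_Mapping.single (Psi p j) (of_bool (i = q))"
| "a_bracket (Psi p q) (E i j) =
     Poly_Mapping.single (Psi p j) (of_bool (i = q)) - Poly_Mapping.single (Psi i q) (of_bool (j = p))"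
| "a_bracket (Psi i j) (Psi p q) = 0"

fun a_form :: "nat \<Rightarrow> nat \<Rightarrow> complex \<Rightarrow> complex \<Rightarrow> gen \<Rightarrow> gen \<Rightarrow> complex" where
  "a_form m n \<alpha>1 \<alpha>2 (E i j) (E p q) =
     (if {i, j, p, q} \<subseteq> {1..m} then
        \<alpha>1 * of_bool (i = q) * of_bool (p = j) + of_bool (i = j) * of_bool (p = q)
      else if {i, j, p, q} \<subseteq> {m+1..m+n} then
        \<alpha>2 * of_bool (i = q) * of_bool (p = j) + of_bool (i = j) * of_bool (p = q)
      else 0)"
| "a_form m n \<alpha>1 \<alpha>2 (E i j) (Psi p q) = 0"
| "a_form m n \<alpha>1 \<alpha>2 (Psi p q) y = 0"

definition a_lsalg :: "nat \<Rightarrow> nat \<Rightarrow> complex \<Rightarrow> complex \<Rightarrow> gen lsalg" where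
  "a_lsalg m n \<alpha>1 \<alpha>2 = \<lparr>basis = a_basis m n, odd_elt = is_Psi, bracket = a_bracket,
     bform = a_form m n \<alpha>1 \<alpha>2\<rparr>"


section \<open>The \<open>W\<close>-algebra\<close>

text \<open>
  In this section \<open>V\<close> stands for \<open>V\<^sup>\<kappa>(\<aa>)\<close> with currents \<open>J\<close>. The vector \<open>g_vec m n V J x s\<close> is
  \<open>x[s]\<close>, for negative \<open>s\<close>, and it is \<open>0\<close> if the indices of \<open>x\<close> are out of range.
\<close>

definition g_vec :: "nat \<Rightarrow> nat \<Rightarrow> 'v::ab_group_add vsalg \<Rightarrow> (gen \<Rightarrow> 'v) \<Rightarrow> gen \<Rightarrow> int \<Rightarrow> 'v" where
  "g_vec m n V J x s = (if x \<in> a_basis m n then nprod V (J x) s (vac V) else 0)"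

text \<open>\<open>V\<^sup>\<kappa>(\<bb>) = U(t\<^sup>-\<^sup>1\<bb>[t\<^sup>-\<^sup>1])\<close> inside \<open>V = U(t\<^sup>-\<^sup>1\<aa>[t\<^sup>-\<^sup>1])\<close>.\<close>

definition Vb :: "nat \<Rightarrow> nat \<Rightarrow> 'v::ab_group_add vsalg \<Rightarrow> (gen \<Rightarrow> 'v) \<Rightarrow> 'v vsalg" where
  "Vb m n V J = sub_vsalg V (module.span (vscale V) (word_vec V J ` neg_words (b_basis m n)))"

text \<open>
  The value of \<open>d\<^sub>0\<close> on \<open>e\<^sub>i\<^sub>,\<^sub>j[-1]\<close>; \<open>i^ = i + n\<close> is defined for \<open>m - n < i \<le> m\<close>, and
  \<open>j~ = j - n\<close> is defined for \<open>m < j \<le> m + n\<close>.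
\<close>

definition d0_gen ::
  "nat \<Rightarrow> nat \<Rightarrow> complex \<Rightarrow> 'v::ab_group_add vsalg \<Rightarrow> (gen \<Rightarrow> 'v) \<Rightarrow> nat \<Rightarrow> nat \<Rightarrow> 'v" where
  "d0_gen m n \<alpha>2 V J i j =
     (\<Sum>r | r \<in> {1..m+n} \<and> col m i > col m r \<and> col m r \<ge> col m j.
        nprod V (g_vec m n V J (E r j) (-1)) (-1) (g_vec m n V J (Psi i r) (-1)))
     - (\<Sum>r | r \<in> {1..m+n} \<and> col m j < col m r \<and> col m r \<le> col m i.
        nprod V (g_vec m n V J (Psi r j) (-1)) (-1) (g_vec m n V J (E i r) (-1)))
     + (if col m i > col m j then vscale V \<alpha>2 (g_vec m n V J (Psi i j) (-2)) else 0)
     + (if m - n < i \<and> i \<le> m then g_vec m n V J (Psi (i + n) j) (-1) else 0)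
     - (if m < j \<and> j \<le> m + n then g_vec m n V J (Psi i (j - n)) (-1) else 0)"

text \<open>
  Only the values of \<open>d\<close> on \<open>V\<^sup>\<kappa>(\<bb>)\<close> matter. All of \<open>V\<^sup>\<kappa>(\<bb>)\<close> is even, so an odd derivation
  has image in the odd part of \<open>V\<close> and no sign appears in the Leibniz rule.
\<close>

definition is_d0 ::
  "nat \<Rightarrow> nat \<Rightarrow> complex \<Rightarrow> 'v::ab_group_add vsalg \<Rightarrow> (gen \<Rightarrow> 'v) \<Rightarrow> ('v \<Rightarrow> 'v) \<Rightarrow> bool" where
  "is_d0 m n \<alpha>2 V J d \<longleftrightarrow>
     (\<forall>u\<in>vspace (Vb m n V J). d u \<in> vpart V True) \<and>
     (\<forall>u\<in>vspace (Vb m n V J). \<forall>v\<in>vspace (Vb m n V J). d (u + v) = d u + d v) \<and>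
     (\<forall>c. \<forall>u\<in>vspace (Vb m n V J). d (vscale V c u) = vscale V c (d u)) \<and>
     (\<forall>u\<in>vspace (Vb m n V J). \<forall>v\<in>vspace (Vb m n V J). \<forall>s.
        d (nprod V u s v) = nprod V (d u) s v + nprod V u s (d v)) \<and>
     d (vac V) = 0 \<and>
     (\<forall>u\<in>vspace (Vb m n V J). d (transl V u) = transl V (d u)) \<and>
     (\<forall>i j. E i j \<in> b_basis m n \<longrightarrow> d (g_vec m n V J (E i j) (-1)) = d0_gen m n \<alpha>2 V J i j)"

definition W_algebra ::
  "nat \<Rightarrow> nat \<Rightarrow> 'v::ab_group_add vsalg \<Rightarrow> (gen \<Rightarrow> 'v) \<Rightarrow> ('v \<Rightarrow> 'v) \<Rightarrow> 'v vsalg" where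
  "W_algebra m n V J d = sub_vsalg (Vb m n V J) {y. d y = 0}"

definition W1_elt ::
  "nat \<Rightarrow> nat \<Rightarrow> 'v::ab_group_add vsalg \<Rightarrow> (gen \<Rightarrow> 'v) \<Rightarrow> nat \<Rightarrow> nat \<Rightarrow> 'v" where
  "W1_elt m n V J i j =
     (\<Sum>(h, l) | h \<in> {1..m+n} \<and> l \<in> {1..m+n} \<and> row m n h = i \<and> row m n l = j \<and> col m h = col m l.
        g_vec m n V J (E h l) (-1))"

definition W2_elt ::
  "nat \<Rightarrow> nat \<Rightarrow> complex \<Rightarrow> 'v::ab_group_add vsalg \<Rightarrow> (gen \<Rightarrow> 'v) \<Rightarrow> nat \<Rightarrow> nat \<Rightarrow> 'v" where
  "W2_elt m n \<alpha>2 V J i j =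
     g_vec m n V J (E (i + n) j) (-1) - vscale V \<alpha>2 (g_vec m n V J (E i j) (-2))
     + (\<Sum>u\<in>{m-n<..m}. nprod V (g_vec m n V J (E u j) (-1)) (-1) (g_vec m n V J (E (i + n) (u + n)) (-1)))
     - (\<Sum>u\<in>{1..m-n}. nprod V (g_vec m n V J (E u j) (-1)) (-1) (g_vec m n V J (E i u) (-1)))"

text \<open>The elements \<open>W\<^sup>(\<^sup>1\<^sup>)\<^sub>i\<^sub>,\<^sub>j\<close> and \<open>W\<^sup>(\<^sup>2\<^sup>)\<^sub>i\<^sub>,\<^sub>j\<close> lie in the \<open>W\<close>-algebra.\<close>

context
  fixes m n :: nat and \<alpha>1 \<alpha>2 :: complex and V :: "'v::ab_group_add vsalg"
    and J :: "gen \<Rightarrow> 'v" and d :: "'v \<Rightarrow> 'v"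
  assumes mn: "1 \<le> n" "n \<le> m"
    and V: "universal_affine V (a_lsalg m n \<alpha>1 \<alpha>2) J"
    and d0: "is_d0 m n \<alpha>2 V J d"
begin

interpretation universal_affine V "a_lsalg m n \<alpha>1 \<alpha>2" J by (rule V)
interpretation vector_space "vscale V" by (rule vector_space)

private abbreviation "S \<equiv> span (word_vec V J ` neg_words (b_basis m n))"
private abbreviation "g \<equiv> g_vec m n V J"

lemma Vb_space: "vspace (Vb m n V J) = S"
proof -
  have "S \<subseteq> vspace V"
    unfolding words_span
    by (rule span_mono) (auto simp: neg_words_def a_lsalg_def a_basis_def)
  then show ?thesis by (auto simp: Vb_def sub_vsalg_def)
qed

lemma word_in: "w \<in> neg_words (b_basis m n) \<Longrightarrow> word_vec V J w \<in> S"
  by (intro span_base imageI)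

lemma J_space: assumes "x \<in> a_basis m n" shows "J x \<in> vspace V"
proof -
  have "J x \<in> vpart V (odd_elt (a_lsalg m n \<alpha>1 \<alpha>2) x)"
    using current_part[of x] assms by (simp add: a_lsalg_def)
  moreover have "0 \<in> vpart V a" for a using subspace_0[OF subspace_part] .
  ultimately show ?thesis unfolding space_eq
    by (cases "odd_elt (a_lsalg m n \<alpha>1 \<alpha>2) x") force+
qed

lemma g_J: "x \<in> a_basis m n \<Longrightarrow> g x (-1) = J x"
  by (simp add: g_vec_def creation(1) J_space)

lemma g_in: assumes "x \<in> b_basis m n" "1 \<le> s" shows "g x (- int s) \<in> S"
  using word_in[of "[(x, s)]"] assms
  by (auto simp: g_vec_def a_basis_def word_vec_def neg_words_def)

lemma gg_in: assumes "x \<in> b_basis m n" "y \<in> b_basis m n" 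
  shows "nprod V (g x (-1)) (-1) (g y (-1)) \<in> S"
  using word_in[of "[(x, 1), (y, 1)]"] assms g_J[of x]
  by (auto simp: g_vec_def a_basis_def word_vec_def neg_words_def)

lemma
  d_add: "u \<in> S \<Longrightarrow> v \<in> S \<Longrightarrow> d (u + v) = d u + d v" and
  d_scale: "u \<in> S \<Longrightarrow> d (vscale V c u) = vscale V c (d u)" and
  d_nprod: "u \<in> S \<Longrightarrow> v \<in> S \<Longrightarrow> d (nprod V u s v) = nprod V (d u) s v + nprod V u s (d v)" and
  d_transl: "u \<in> S \<Longrightarrow> d (transl V u) = transl V (d u)" and
  d_gen: "E i j \<in> b_basis m n \<Longrightarrow> d (g (E i j) (-1)) = d0_gen m n \<alpha>2 V J i j" and
  d_odd: "u \<in> S \<Longrightarrow> d u \<in> vpart V True" and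
  d_vac: "d (vac V) = 0"
  using d0 unfolding is_d0_def Vb_space by auto

lemma d_0: "d 0 = 0"
  using d_add[OF span_zero span_zero] by simp

lemma d_diff: assumes "u \<in> S" "v \<in> S" shows "d (u - v) = d u - d v"
  using d_add[OF span_diff[OF assms] assms(2)] by (simp add: algebra_simps)

lemma d_sum: "(\<And>x. x \<in> A \<Longrightarrow> f x \<in> S) \<Longrightarrow> d (sum f A) = (\<Sum>x\<in>A. d (f x))"
  by (induction A rule: infinite_finite_induct) (auto simp: d_0 d_add span_sum)

lemma d0_gen_diag: assumes "i \<in> {1..m+n}" "j \<in> {1..m+n}" "col m i = col m j"
  shows "d (g (E i j) (-1)) = 
     (if m - n < i \<and> i \<le> m then g (Psi (i + n) j) (-1) else 0)
     - (if m < j then g (Psi i (j - n)) (-1) else 0)"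
proof -
  have e: "{r \<in> {1..m+n}. col m r < col m i \<and> col m j \<le> col m r} = {}"
    "{r \<in> {1..m+n}. col m j < col m r \<and> col m r \<le> col m i} = {}"
    using assms(3) by auto
  have b: "E i j \<in> b_basis m n" using assms by (auto simp: b_basis_def)
  show ?thesis using assms unfolding d_gen[OF b] d0_gen_def e by simp
qed

lemma W1_sum:
  assumes "(1 \<le> i \<and> i \<le> m - n \<and> 1 \<le> j \<and> j \<le> m) \<or> (m - n < i \<and> i \<le> m \<and> m - n < j \<and> j \<le> m)"
  shows "W1_elt m n V J i j = g (E i j) (-1) + (if m - n < i then g (E (i + n) (j + n)) (-1) else 0)"
proof -
  have "{(h, l). h \<in> {1..m+n} \<and> l \<in> {1..m+n} \<and> row m n h = i \<and> row m n l = j \<and> col m h = col m l}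
    = (if m - n < i then {(i, j), (i + n, j + n)} else {(i, j)})"
    using assms mn by (auto simp: row_def col_def split: if_splits)
  then show ?thesis unfolding W1_elt_def using mn by simp
qed

lemma W_space: "vspace (W_algebra m n V J d) = {y \<in> S. d y = 0}"
  unfolding W_algebra_def sub_vsalg_def using Vb_space by auto

lemma W1_in_W:
  assumes "(1 \<le> i \<and> i \<le> m - n \<and> 1 \<le> j \<and> j \<le> m) \<or> (m - n < i \<and> i \<le> m \<and> m - n < j \<and> j \<le> m)"
  shows "W1_elt m n V J i j \<in> vspace (W_algebra m n V J d)"
proof -
  have b: "E i j \<in> b_basis m n" "m - n < i \<Longrightarrow> E (i + n) (j + n) \<in> b_basis m n"
    using assms mn by (auto simp: b_basis_def col_def)
  have 1: "g (E i j) (-1) \<in> S" using g_in[OF b(1), of 1] by simp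
  have 2: "m - n < i \<Longrightarrow> g (E (i + n) (j + n)) (-1) \<in> S" using g_in[OF b(2), of 1] by simp
  have "W1_elt m n V J i j \<in> S"
    unfolding W1_sum[OF assms] using 1 2 by (auto intro: span_add span_zero)
  moreover have "d (W1_elt m n V J i j) = 0"
  proof (cases "m - n < i")
    case True
    with assms mn have a: "m - n < j" "i \<le> m" "j \<le> m" by auto
    have "d (W1_elt m n V J i j) = d (g (E i j) (-1)) + d (g (E (i + n) (j + n)) (-1))"
      unfolding W1_sum[OF assms] using True 1 2 by (simp add: d_add)
    also have "\<dots> = 0"
      using True a mn by (subst (1 2) d0_gen_diag) (auto simp: col_def)
    finally show ?thesis .
  next
    case False
    have "d (W1_elt m n V J i j) = d (g (E i j) (-1))"
      unfolding W1_sum[OF assms] using False by simp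
    also have "\<dots> = 0"
      using False assms mn by (subst d0_gen_diag) (auto simp: col_def)
    finally show ?thesis .
  qed
  ultimately show ?thesis by (simp add: W_space)
qed

lemma part_space: "u \<in> vpart V a \<Longrightarrow> u \<in> vspace V"
  using subspace_0[OF subspace_part[of True]] subspace_0[OF subspace_part[of False]]
  unfolding space_eq by (cases a) force+

lemma nprod_0: assumes "u \<in> vspace V" shows "nprod V u s 0 = 0" "nprod V 0 s u = 0"
proof -
  have z: "0 \<in> vspace V" using part_space subspace_0[OF subspace_part[of True]] by blast
  show "nprod V u s 0 = 0" using nprod_add_right[OF assms z z, of s] by simp
  show "nprod V 0 s u = 0" using nprod_add_left[OF z z assms, of s] by simp
qed

lemma nprod_minus: assumes "u \<in> vspace V" "v \<in> vspace V" shows "nprod V u s (- v) = - nprod V u s v"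
  using nprod_scale_right[OF assms, of s "-1"] by simp

lemma g_space: "x \<in> a_basis m n \<Longrightarrow> g x (-1) \<in> vspace V"
  by (simp add: g_J J_space)

lemma W2_in_W:
  assumes i: "m - n < i" "i \<le> m" and j: "1 \<le> j" "j \<le> m"
  shows "W2_elt m n \<alpha>2 V J i j \<in> vspace (W_algebra m n V J d)"
proof -
  let ?e = "\<lambda>i j. g (E i j) (-1)" and ?p = "\<lambda>i j. g (Psi i j) (-1)"
  let ?P = "\<lambda>u v. nprod V u (-1) v"
  have iin: "i \<in> {1..m+n}" "i + n \<in> {1..m+n}" "m < i + n" using i mn by auto
  have b1: "E (i + n) j \<in> b_basis m n" "E i j \<in> b_basis m n"
    using i j mn by (auto simp: b_basis_def col_def)
  have b2: "E u j \<in> b_basis m n" "E (i + n) (u + n) \<in> b_basis m n" if "u \<in> {m-n<..m}" for u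
    using i j mn that by (auto simp: b_basis_def col_def)
  have b3: "E u j \<in> b_basis m n" "E i u \<in> b_basis m n" if "u \<in> {1..m-n}" for u
    using i j mn that by (auto simp: b_basis_def col_def)
  have s1: "?e (i + n) j \<in> S" "?e i j \<in> S" "g (E i j) (-2) \<in> S"
    using g_in[OF b1(1), of 1] g_in[OF b1(2), of 1] g_in[OF b1(2), of 2] by auto
  have s2: "?e u j \<in> S" "?e (i + n) (u + n) \<in> S" "?P (?e u j) (?e (i + n) (u + n)) \<in> S"
    if "u \<in> {m-n<..m}" for u
    using g_in[OF b2(1)[OF that], of 1] g_in[OF b2(2)[OF that], of 1] gg_in b2[OF that] by auto
  have s3: "?e u j \<in> S" "?e i u \<in> S" "?P (?e u j) (?e i u) \<in> S"
    if "u \<in> {1..m-n}" for u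
    using g_in[OF b3(1)[OF that], of 1] g_in[OF b3(2)[OF that], of 1] gg_in b3[OF that] by auto
  have inS: "W2_elt m n \<alpha>2 V J i j \<in> S"
    unfolding W2_elt_def using s1 s2(3) s3(3) by (intro span_add span_diff span_scale span_sum) auto
  have vs: "g x (-1) \<in> vspace V" if "x \<in> b_basis m n" for x
    using that by (intro g_space) (simp add: a_basis_def)
  have psi: "Psi (i + n) u \<in> a_basis m n" if "u \<in> {1..m}" for u
    using that i mn by (auto simp: a_basis_def col_def)
  have T: "g (E i j) (-2) = transl V (?e i j)" "g (Psi (i + n) j) (-2) = transl V (?p (i + n) j)"
  proof -
    have "g x (-2) = transl V (g x (-1))" if "x \<in> a_basis m n" for x
      using that by (simp add: translation g_space) (simp add: g_J, simp add: g_vec_def)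
    moreover have "E i j \<in> a_basis m n" using b1(2) by (simp add: a_basis_def)
    ultimately show "g (E i j) (-2) = transl V (?e i j)"
      "g (Psi (i + n) j) (-2) = transl V (?p (i + n) j)"
      using psi[of j] j by auto
  qed
  have de: "d (?e u j) = (if m - n < u then ?p (u + n) j else 0)" if "u \<in> {1..m}" for u
    using that j mn by (subst d0_gen_diag) (auto simp: col_def)
  have de1: "d (?e i u) = ?p (i + n) u" if "u \<in> {1..m}" for u
    using that i mn by (subst d0_gen_diag) (auto simp: col_def)
  have de2: "d (?e (i + n) (u + n)) = - ?p (i + n) u" if "u \<in> {m-n<..m}" for u
    using that iin mn by (subst d0_gen_diag) (auto simp: col_def)
  have A: "{r \<in> {1..m + n}. col m r < col m (i + n) \<and> col m j \<le> col m r} = {1..m-n} \<union> {m-n<..m}"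
    using iin i j mn by (auto simp: col_def split: if_splits)
  have B: "{r \<in> {1..m + n}. col m j < col m r \<and> col m r \<le> col m (i + n)} = (\<lambda>u. u + n) ` {m-n<..m}"
  proof (intro set_eqI iffI)
    fix r assume "r \<in> {r \<in> {1..m + n}. col m j < col m r \<and> col m r \<le> col m (i + n)}"
    then have "m < r" "r \<le> m + n" using iin i j mn by (auto simp: col_def split: if_splits)
    then show "r \<in> (\<lambda>u. u + n) ` {m-n<..m}" using mn by (intro image_eqI[of _ _ "r - n"]) auto
  qed (use iin i j mn in \<open>auto simp: col_def split: if_splits\<close>)
  have d1: "d (?e (i + n) j) =
      (\<Sum>u\<in>{1..m-n}. ?P (?e u j) (?p (i + n) u)) + (\<Sum>u\<in>{m-n<..m}. ?P (?e u j) (?p (i + n) u))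
      - (\<Sum>u\<in>{m-n<..m}. ?P (?p (u + n) j) (?e (i + n) (u + n)))
      + vscale V \<alpha>2 (g (Psi (i + n) j) (-2))"
    unfolding d_gen[OF b1(1)] d0_gen_def A B
    using iin j mn by (subst sum.union_disjoint) (auto simp: sum.reindex col_def)
  have d2: "d (vscale V \<alpha>2 (g (E i j) (-2))) = vscale V \<alpha>2 (g (Psi (i + n) j) (-2))"
    using s1 j by (simp add: d_scale T d_transl de1)
  have d3: "d (\<Sum>u\<in>{m-n<..m}. ?P (?e u j) (?e (i + n) (u + n))) =
      (\<Sum>u\<in>{m-n<..m}. ?P (?p (u + n) j) (?e (i + n) (u + n)))
      - (\<Sum>u\<in>{m-n<..m}. ?P (?e u j) (?p (i + n) u))"
  proof -
    have "d (?P (?e u j) (?e (i + n) (u + n))) =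
        ?P (?p (u + n) j) (?e (i + n) (u + n)) - ?P (?e u j) (?p (i + n) u)"
      if u: "u \<in> {m-n<..m}" for u
      using u s2[OF u] vs[OF b2(1)[OF u]] g_space[OF psi[of u]]
      by (simp add: d_nprod de de2 nprod_minus)
    then show ?thesis
      unfolding sum_subtractf[symmetric]
      by (subst d_sum[OF s2(3)]) (assumption, rule sum.cong[OF refl])
  qed
  have d4: "d (\<Sum>u\<in>{1..m-n}. ?P (?e u j) (?e i u)) = (\<Sum>u\<in>{1..m-n}. ?P (?e u j) (?p (i + n) u))"
  proof -
    have "d (?P (?e u j) (?e i u)) = ?P (?e u j) (?p (i + n) u)" if u: "u \<in> {1..m-n}" for u
    proof -
      have "u \<in> {1..m}" "\<not> m - n < u" using u by auto
      then show ?thesis using s3[OF u] vs[OF b3(2)[OF u]]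
        by (simp only: d_nprod de de1 nprod_0 if_False add_0)
    qed
    then show ?thesis
      by (subst d_sum[OF s3(3)]) (assumption, rule sum.cong[OF refl])
  qed
  have t: "vscale V \<alpha>2 (g (E i j) (-2)) \<in> S"
    "(\<Sum>u\<in>{m-n<..m}. ?P (?e u j) (?e (i + n) (u + n))) \<in> S"
    "(\<Sum>u\<in>{1..m-n}. ?P (?e u j) (?e i u)) \<in> S"
    using s1 s2(3) s3(3) by (auto intro: span_scale span_sum)
  have "d (W2_elt m n \<alpha>2 V J i j) = 0"
    unfolding W2_elt_def using s1 t
    by (simp add: d_diff d_add span_diff span_add d1 d2 d3 d4 del: One_nat_def)
  with inS show ?thesis by (simp add: W_space)
qed

end

end

theory Submission
  imports Defs
begin

text \<open>
  For even currents \<open>x\<close>, \<open>y\<close> of an affine vertex superalgebra and \<open>s \<ge> 0\<close>, the Borcherds identity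
  gives \<open>x\<^sub>(\<^sub>s\<^sub>) y\<^sub>(\<^sub>r\<^sub>) w = y\<^sub>(\<^sub>r\<^sub>) x\<^sub>(\<^sub>s\<^sub>) w + [x, y]\<^sub>(\<^sub>s\<^sub>+\<^sub>r\<^sub>) w + \<delta>(s + r = 0) s \<kappa>(x, y) w\<close>.
  Since \<open>W\<^sup>(\<^sup>1\<^sup>)\<close> is a sum of at most two currents \<open>e\<^sub>p\<^sub>,\<^sub>q\<close> and \<open>e\<^sub>p\<^sub>+\<^sub>n\<^sub>,\<^sub>q\<^sub>+\<^sub>n\<close>, and every term of \<open>W\<^sup>(\<^sup>2\<^sup>)\<close> is a
  word of length at most two in the currents, this evaluates all products term by term. The coefficients
  combine because \<open>\<alpha>\<^sub>2 - \<alpha>\<^sub>1 = m - n\<close> is the number of summands of the last sum in \<open>W\<^sup>(\<^sup>2\<^sup>)\<close>. In the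
  case \<open>p > m - n\<close> the normally ordered product \<open>e\<^sub>p\<^sub>,\<^sub>j e\<^sub>i\<^sub>+\<^sub>n\<^sub>,\<^sub>q\<^sub>+\<^sub>n\<close> arises from both currents and cancels.
\<close>

section \<open>Linearity of the products and the commutator formula\<close>

context vertex_superalgebra
begin

sublocale vector_space "vscale V" by (rule vector_space)

lemma part_in_space: "u \<in> vpart V a \<Longrightarrow> u \<in> vspace V"
  using subspace_0[OF subspace_part[of True]] subspace_0[OF subspace_part[of False]]
  unfolding space_eq by (cases a) force+

lemma subspace_vspace: "subspace (vspace V)"
  unfolding space_eq by (intro subspace_sums subspace_part)

lemmas vspace_intros [simp, intro] =
  subspace_0[OF subspace_vspace] subspace_add[OF subspace_vspace] subspace_diff[OF subspace_vspace]
  subspace_neg[OF subspace_vspace] subspace_scale[OF subspace_vspace]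
  subspace_sum[OF subspace_vspace] part_in_space[OF vac_even]

text \<open>The axioms locate products only for homogeneous arguments, so both vectors are first
  split into even and odd parts.\<close>

lemma nprod_space [simp, intro]:
  assumes "u \<in> vspace V" "v \<in> vspace V"
  shows "nprod V u s v \<in> vspace V"
proof -
  obtain u0 u1 v0 v1 where uv: "u = u0 + u1" "v = v0 + v1"
    "u0 \<in> vpart V False" "u1 \<in> vpart V True" "v0 \<in> vpart V False" "v1 \<in> vpart V True"
    using assms unfolding space_eq by blast
  show ?thesis
    unfolding uv(1,2) using uv(3-)
    by (simp add: nprod_add_left nprod_add_right part_in_space)
      (intro vspace_intros; blast intro: part_in_space nprod_part)
qed

lemma nprod_zero_right [simp]: "u \<in> vspace V \<Longrightarrow> nprod V u s 0 = 0"
  using nprod_scale_right[of u 0 s 0] by simp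

lemma nprod_zero_left [simp]: "u \<in> vspace V \<Longrightarrow> nprod V 0 s u = 0"
  using nprod_scale_left[of 0 u 0 s] by simp

lemma nprod_diff_left:
  "\<lbrakk>u \<in> vspace V; u' \<in> vspace V; v \<in> vspace V\<rbrakk> \<Longrightarrow>
    nprod V (u - u') s v = nprod V u s v - nprod V u' s v"
  using nprod_add_left[of "u - u'" u' v s] by (simp add: algebra_simps)

lemma nprod_diff_right:
  "\<lbrakk>u \<in> vspace V; v \<in> vspace V; v' \<in> vspace V\<rbrakk> \<Longrightarrow>
    nprod V u s (v - v') = nprod V u s v - nprod V u s v'"
  using nprod_add_right[of u "v - v'" v' s] by (simp add: algebra_simps)

lemma nprod_sum_right:
  "u \<in> vspace V \<Longrightarrow> (\<And>x. x \<in> A \<Longrightarrow> f x \<in> vspace V) \<Longrightarrow>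
    nprod V u s (sum f A) = (\<Sum>x\<in>A. nprod V u s (f x))"
  by (induction A rule: infinite_finite_induct) (simp_all add: nprod_add_right)

text \<open>This is the Borcherds identity at \<open>p = s\<close>, \<open>r = 0\<close>. On the
  right the coefficients \<open>0 gchoose l\<close> leave only \<open>l = 0\<close>, on the left
  \<open>s choose l\<close> vanishes for \<open>l > s\<close>, and no sign occurs because
  \<open>u\<close> is even.\<close>

lemma commutator_formula:
  assumes u: "u \<in> vpart V False" and v: "v \<in> vpart V b" and w: "w \<in> vspace V"
  shows "nprod V u (int s) (nprod V v q w) = nprod V v q (nprod V u (int s) w) +
    (\<Sum>l\<le>s. vscale V (of_nat (s choose l)) (nprod V (nprod V u (int l) v) (int s + q - int l) w))"
proof -
  let ?f = "\<lambda>l::nat. vscale V (of_int (int s) gchoose l)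
    (nprod V (nprod V u (0 + int l) v) (int s + q - int l) w)"
  let ?g = "\<lambda>l::nat. vscale V ((-1) ^ l * (of_int 0 gchoose l))
    (nprod V u (int s + 0 - int l) (nprod V v (q + int l) w)
     - vscale V ((-1) powi 0 * ksign False b)
         (nprod V v (q + 0 - int l) (nprod V u (int s + int l) w)))"
  have "Sum_any ?f = sum ?f {..s}"
    by (rule Sum_any.expand_superset) (auto simp flip: binomial_gbinomial intro: ccontr)
  moreover have "Sum_any ?g = sum ?g {0}"
  proof (rule Sum_any.expand_superset)
    have "?g l = 0" if "l \<noteq> 0" for l using that by (cases l) simp_all
    then show "{l. ?g l \<noteq> 0} \<subseteq> {0}" by blast
  qed simp
  ultimately have "sum ?f {..s} = ?g 0"
    using borcherds[OF u v w, of "int s" 0 q] by simp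
  then show ?thesis
    by (simp add: ksign_def algebra_simps flip: binomial_gbinomial)
qed

end

text \<open>The bracket of two matrix units is such a difference. Its support can be smaller than
  \<open>{x, y}\<close>, since coefficients may be zero or cancel when \<open>x = y\<close>; hence
  the sum is first enlarged to \<open>{x, y}\<close>.\<close>

lemma (in module) sum_scale_single_diff:
  fixes f :: "'x \<Rightarrow> 'b"
  defines "c a x b y \<equiv> Poly_Mapping.single x a - Poly_Mapping.single y b"
  shows "(\<Sum>z\<in>Poly_Mapping.keys (c a x b y). scale (Poly_Mapping.lookup (c a x b y) z) (f z)) =
    scale a (f x) - scale b (f y)"
proof -
  have "(\<Sum>z\<in>Poly_Mapping.keys (c a x b y). scale (Poly_Mapping.lookup (c a x b y) z) (f z)) =
    (\<Sum>z\<in>{x, y}. scale (Poly_Mapping.lookup (c a x b y) z) (f z))"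
    by (rule sum.mono_neutral_left)
      (auto simp: c_def in_keys_iff lookup_minus lookup_single when_def split: if_splits)
  then show ?thesis
    by (cases "x = y") (auto simp: c_def lookup_minus lookup_single scale_left_diff_distrib)
qed

section \<open>Commutators of currents in a universal affine vertex superalgebra\<close>

context universal_affine
begin

lemma current_space: "x \<in> basis L \<Longrightarrow> J x \<in> vspace V"
  by (rule part_in_space[OF current_part])

text \<open>The OPE kills every \<open>l >= 2\<close> in the commutator formula. The term
  \<open>l = 1\<close> comes from a multiple of the vacuum, whose product of index
  \<open>s + q - 1\<close> is the identity if \<open>s + q = 0\<close> and zero otherwise.\<close>

lemma current_commutator:
  assumes x: "x \<in> basis L" "\<not> odd_elt L x" and y: "y \<in> basis L" and w: "w \<in> vspace V"
  shows "nprod V (J x) (int s) (nprod V (J y) q w) =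
    nprod V (J y) q (nprod V (J x) (int s) w) + nprod V (nprod V (J x) 0 (J y)) (int s + q) w +
    (if int s + q = 0 then vscale V (of_nat s * bform L x y) w else 0)"
proof -
  let ?f = "\<lambda>l. vscale V (of_nat (s choose l))
    (nprod V (nprod V (J x) (int l) (J y)) (int s + q - int l) w)"
  have f: "?f l = 0" if "2 \<le> l" for l
    using that x y w by (simp add: ope_ge_2)
  \<comment> \<open>The added term has coefficient \<open>s choose Suc s = 0\<close>; it brings both
    0 and 1 into the range even when \<open>s = 0\<close>.\<close>
  have "(\<Sum>l\<le>s. ?f l) = (\<Sum>l\<le>Suc s. ?f l)" by simp
  also have "\<dots> = (\<Sum>l\<in>{0, 1}. ?f l)"
  proof (rule sum.mono_neutral_right)
    show "\<forall>l\<in>{..Suc s} - {0, 1}. ?f l = 0" using f by (auto simp: numeral_2_eq_2 le_Suc_eq)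
  qed auto
  finally show ?thesis
    using x y w current_part[of x] current_part[of y]
    by (subst commutator_formula) (auto simp: ope_1 nprod_scale_left vacuum)
qed

end

section \<open>Products of the currents \<open>e a b\<close> with words of length at most
  two\<close>

context
  fixes m n :: nat and \<alpha>1 \<alpha>2 :: complex and V :: "'v::ab_group_add vsalg" and J :: "gen \<Rightarrow> 'v"
  assumes mn: "1 \<le> n" "n \<le> m"
    and V: "universal_affine V (a_lsalg m n \<alpha>1 \<alpha>2) J"
begin

interpretation universal_affine V "a_lsalg m n \<alpha>1 \<alpha>2" J by (rule V)

private abbreviation "e a b \<equiv> g_vec m n V J (E a b) (-1)"
private abbreviation "\<kappa> a b c d \<equiv> a_form m n \<alpha>1 \<alpha>2 (E a b) (E c d)"

lemma E_in_basis: "E a b \<in> b_basis m n \<Longrightarrow> E a b \<in> basis (a_lsalg m n \<alpha>1 \<alpha>2)"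
  by (simp add: a_lsalg_def a_basis_def)

lemma E_in_b_basis_iff:
  "E a b \<in> b_basis m n \<longleftrightarrow> 1 \<le> a \<and> a \<le> m + n \<and> 1 \<le> b \<and> b \<le> m + n \<and> (b \<le> m \<or> m < a)"
  by (auto simp: b_basis_def col_def)

lemma e_eq_current: "E a b \<in> b_basis m n \<Longrightarrow> e a b = J (E a b)"
  using current_space[of "E a b"] by (simp add: g_vec_def creation a_lsalg_def a_basis_def)

text \<open>Valid for all indices because \<open>g_vec\<close> returns 0 outside
  \<open>a_basis\<close>.\<close>

lemma e_space [simp, intro]: "e a b \<in> vspace V"
  using current_space[of "E a b"] by (auto simp: g_vec_def a_lsalg_def)

lemma e_bracket:
  assumes "E a b \<in> b_basis m n" "E c d \<in> b_basis m n"
  shows "nprod V (J (E a b)) 0 (J (E c d)) = (if b = c then e a d else 0) - (if a = d then e c b else 0)"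
proof -
  have "nprod V (J (E a b)) 0 (J (E c d)) =
    vscale V (of_bool (b = c)) (J (E a d)) - vscale V (of_bool (a = d)) (J (E c b))"
    using E_in_basis[OF assms(1)] E_in_basis[OF assms(2)]
    by (simp only: ope_0) (simp add: a_lsalg_def lin_ext_def sum_scale_single_diff)
  \<comment> \<open>\<open>J\<close> agrees with \<open>e\<close> only on the basis. When a delta is
    nonzero, the product of the matrix units stays in it, since \<open>col\<close> decreases weakly
    from left to right index.\<close>
  moreover have "b = c \<Longrightarrow> E a d \<in> b_basis m n" "a = d \<Longrightarrow> E c b \<in> b_basis m n"
    using assms by (auto simp: E_in_b_basis_iff)
  ultimately show ?thesis by (auto simp: e_eq_current)
qed

lemma e_commutator:
  assumes "E a b \<in> b_basis m n" "E c d \<in> b_basis m n" "w \<in> vspace V"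
  shows "nprod V (e a b) (int s) (nprod V (e c d) r w) =
    nprod V (e c d) r (nprod V (e a b) (int s) w)
    + (if b = c then nprod V (e a d) (int s + r) w else 0)
    - (if a = d then nprod V (e c b) (int s + r) w else 0)
    + (if int s + r = 0 then vscale V (of_nat s * \<kappa> a b c d) w else 0)"
proof -
  have "\<not> odd_elt (a_lsalg m n \<alpha>1 \<alpha>2) (E a b)"
    "bform (a_lsalg m n \<alpha>1 \<alpha>2) (E a b) (E c d) = \<kappa> a b c d" by (simp_all add: a_lsalg_def)
  then show ?thesis
    using assms current_commutator[of "E a b" "E c d" w s r]
    by (simp add: e_eq_current[OF assms(1)] e_eq_current[OF assms(2)] E_in_basis e_bracket nprod_diff_left)
qed

lemma nprod_e_e:
  assumes "E a b \<in> b_basis m n" "E c d \<in> b_basis m n"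
  shows "nprod V (e a b) 0 (e c d) = (if b = c then e a d else 0) - (if a = d then e c b else 0)"
    and "nprod V (e a b) 1 (e c d) = vscale V (\<kappa> a b c d) (vac V)"
    and "2 \<le> s \<Longrightarrow> nprod V (e a b) s (e c d) = 0"
proof -
  note J = e_eq_current[OF assms(1)] e_eq_current[OF assms(2)]
  show "nprod V (e a b) 0 (e c d) = (if b = c then e a d else 0) - (if a = d then e c b else 0)"
    unfolding J by (rule e_bracket[OF assms])
  have "bform (a_lsalg m n \<alpha>1 \<alpha>2) (E a b) (E c d) = \<kappa> a b c d" by (simp add: a_lsalg_def)
  then show "nprod V (e a b) 1 (e c d) = vscale V (\<kappa> a b c d) (vac V)"
    unfolding J using ope_1[OF E_in_basis[OF assms(1)] E_in_basis[OF assms(2)]] by (simp only:)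
  show "nprod V (e a b) s (e c d) = 0" if "2 \<le> s"
    unfolding J using ope_ge_2[OF E_in_basis[OF assms(1)] E_in_basis[OF assms(2)] that] .
qed

text \<open>Apply \<open>e_commutator\<close> to the vacuum, which nonnegative modes annihilate.
  Index 1 shifts \<open>-2\<close> to \<open>-1\<close>, which returns the current itself; index 2
  leaves only the central term.\<close>

lemma nprod_e_e_minus_2:
  assumes "E a b \<in> b_basis m n" "E c d \<in> b_basis m n"
  shows "nprod V (e a b) 0 (nprod V (e c d) (-2) (vac V)) =
      (if b = c then nprod V (e a d) (-2) (vac V) else 0)
      - (if a = d then nprod V (e c b) (-2) (vac V) else 0)"
    and "nprod V (e a b) 1 (nprod V (e c d) (-2) (vac V)) =
      (if b = c then e a d else 0) - (if a = d then e c b else 0)"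
    and "nprod V (e a b) 2 (nprod V (e c d) (-2) (vac V)) = vscale V (2 * \<kappa> a b c d) (vac V)"
    and "3 \<le> s \<Longrightarrow> nprod V (e a b) (int s) (nprod V (e c d) (-2) (vac V)) = 0"
  using e_commutator[OF assms, of "vac V" 0 "-2"] e_commutator[OF assms, of "vac V" 1 "-2"]
    e_commutator[OF assms, of "vac V" 2 "-2"] e_commutator[OF assms, of "vac V" s "-2"]
  by (auto simp: creation)

text \<open>This is \<open>e_commutator\<close> at \<open>r = -1\<close>. The central term appears
  only in index 1; from there on the bracket terms are nonnegative products, that is, second
  contractions.\<close>

lemma nprod_e_normally_ordered:
  assumes "E a b \<in> b_basis m n" "E c d \<in> b_basis m n"
  shows "nprod V (e a b) 0 (nprod V (e c d) (-1) (e f h)) =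
      nprod V (e c d) (-1) (nprod V (e a b) 0 (e f h)) + (if b = c then nprod V (e a d) (-1) (e f h) else 0)
      - (if a = d then nprod V (e c b) (-1) (e f h) else 0)"
    and "nprod V (e a b) 1 (nprod V (e c d) (-1) (e f h)) =
      nprod V (e c d) (-1) (nprod V (e a b) 1 (e f h)) + (if b = c then nprod V (e a d) 0 (e f h) else 0)
      - (if a = d then nprod V (e c b) 0 (e f h) else 0) + vscale V (\<kappa> a b c d) (e f h)"
    and "2 \<le> s \<Longrightarrow> nprod V (e a b) (int s) (nprod V (e c d) (-1) (e f h)) =
      nprod V (e c d) (-1) (nprod V (e a b) (int s) (e f h))
      + (if b = c then nprod V (e a d) (int s - 1) (e f h) else 0)
      - (if a = d then nprod V (e c b) (int s - 1) (e f h) else 0)"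
  using e_commutator[OF assms, of "e f h" 0 "-1"] e_commutator[OF assms, of "e f h" 1 "-1"]
    e_commutator[OF assms, of "e f h" s "-1"]
  by auto

lemma a_form_first_block:
  assumes "a \<in> {1..m}" "b \<in> {1..m}" "c \<in> {1..m}" "r \<in> {1..m}"
  shows "\<kappa> a b c r = \<alpha>1 * of_bool (a = r \<and> c = b) + of_bool (a = b \<and> c = r)"
proof -
  have "{a, b, c, r} \<subseteq> {1..m}" using assms by blast
  then show ?thesis unfolding a_form.simps by (simp only: if_True of_bool_conj mult.assoc)
qed

lemma a_form_second_block:
  assumes "a \<in> {m-n<..m}" "b \<in> {m-n<..m}" "c \<in> {m-n<..m}" "r \<in> {m-n<..m}"
  shows "\<kappa> (a + n) (b + n) (c + n) (r + n) = \<alpha>2 * of_bool (a = r \<and> c = b) + of_bool (a = b \<and> c = r)"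
proof -
  have "\<not> {a + n, b + n, c + n, r + n} \<subseteq> {1..m}"
    "{a + n, b + n, c + n, r + n} \<subseteq> {m+1..m+n}" using assms mn by auto
  then show ?thesis
    unfolding a_form.simps by (simp only: if_True if_False of_bool_conj mult.assoc add_right_cancel)
qed

text \<open>One index in each block rules out both cases of \<open>a_form\<close>, leaving its
  default value 0.\<close>

lemma a_form_mixed_cols:
  assumes "a \<le> m" "m < c"
  shows "\<kappa> a b c r = 0" "\<kappa> c b r a = 0"
proof -
  have "\<not> {a, b, c, r} \<subseteq> {1..m}" "\<not> {a, b, c, r} \<subseteq> {m+1..m+n}"
    "\<not> {c, b, r, a} \<subseteq> {1..m}" "\<not> {c, b, r, a} \<subseteq> {m+1..m+n}"
    using assms by auto
  then show "\<kappa> a b c r = 0" "\<kappa> c b r a = 0"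
    unfolding a_form.simps by (simp_all only: if_False)
qed

text \<open>From index 1 on only the form can contribute, and \<open>a <= m < i + n\<close> mixes
  the blocks.\<close>

lemma nprod_e_e_mixed_cols:
  assumes "a \<in> {1..m}" "b \<in> {1..m}" "i \<in> {m-n<..m}" "c \<in> {1..m+n}" "1 \<le> s"
  shows "nprod V (e a b) s (e (i + n) c) = 0"
proof -
  have E: "E a b \<in> b_basis m n" "E (i + n) c \<in> b_basis m n"
    using assms mn by (auto simp: E_in_b_basis_iff)
  have "s = 1 \<or> 2 \<le> s" using assms by linarith
  then show ?thesis
    using nprod_e_e(2)[OF E] nprod_e_e(3)[OF E, of s] a_form_mixed_cols(1)[of a "i + n" b c] assms by auto
qed

section \<open>Products of a current with the two quadratic sums of \<open>W2_elt\<close>\<close>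

private abbreviation "hats i j \<equiv> (\<Sum>u\<in>{m-n<..m}. nprod V (e u j) (-1) (e (i + n) (u + n)))"
private abbreviation "lows i j \<equiv> (\<Sum>u\<in>{1..m-n}. nprod V (e u j) (-1) (e i u))"
private abbreviation "de i j \<equiv> nprod V (e i j) (-2) (vac V)"

context
  fixes p q i j :: nat
  assumes pq: "p \<in> {1..m}" "q \<in> {1..m}" and ij: "i \<in> {m-n<..m}" "j \<in> {1..m}"
begin

text \<open>Since \<open>p, q <= m\<close> while \<open>i + n, u + n > m\<close>, all nonnegative
  products of \<open>e p q\<close> with the second factor vanish, so only the first factor
  \<open>e u j\<close> is affected.\<close>

lemma nprod_e_hats:
  "nprod V (e p q) 0 (hats i j) =
    (if m - n < q then nprod V (e p j) (-1) (e (i + n) (q + n)) else 0) - (if p = j then hats i q else 0)"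
  "nprod V (e p q) 1 (hats i j) =
    (if p = j \<and> m - n < q then vscale V \<alpha>1 (e (i + n) (q + n)) else 0)
    + (if p = q \<and> m - n < j then e (i + n) (j + n) else 0)"
  "2 \<le> s \<Longrightarrow> nprod V (e p q) (int s) (hats i j) = 0"
proof -
  note simps = nprod_e_normally_ordered nprod_e_e E_in_b_basis_iff nprod_zero_right nprod_e_e_mixed_cols less_diff_conv2[OF mn(2)]
  let ?f = "\<lambda>u. nprod V (e u j) (-1) (e (i + n) (u + n))"
  have 0: "nprod V (e p q) 0 (?f u) = (if q = u then nprod V (e p j) (-1) (e (i + n) (u + n)) else 0)
      - (if p = j then nprod V (e u q) (-1) (e (i + n) (u + n)) else 0)" if "u \<in> {m-n<..m}" for u
    using that pq ij mn by (auto simp: simps)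
  show "nprod V (e p q) 0 (hats i j) =
    (if m - n < q then nprod V (e p j) (-1) (e (i + n) (q + n)) else 0) - (if p = j then hats i q else 0)"
    using 0 pq by (simp add: nprod_sum_right sum_subtractf)
  \<comment> \<open>The conditionals are nested with the test on \<open>u\<close> outermost so that
    the sum over \<open>u\<close> collapses as a delta sum.\<close>
  have 1: "nprod V (e p q) 1 (?f u) = (if q = u then if p = j then vscale V \<alpha>1 (e (i + n) (u + n)) else 0 else 0)
      + (if j = u then if p = q then e (i + n) (u + n) else 0 else 0)" if "u \<in> {m-n<..m}" for u
  proof -
    have "nprod V (e p q) 1 (?f u) = vscale V (\<kappa> p q u j) (e (i + n) (u + n))"
      using that pq ij mn by (auto simp: simps simp del: a_form.simps)
    also have "\<kappa> p q u j = \<alpha>1 * of_bool (p = j \<and> u = q) + of_bool (p = q \<and> u = j)"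
      using that pq ij by (intro a_form_first_block) auto
    finally show ?thesis by (auto simp: scale_left_distrib)
  qed
  show "nprod V (e p q) 1 (hats i j) =
    (if p = j \<and> m - n < q then vscale V \<alpha>1 (e (i + n) (q + n)) else 0)
    + (if p = q \<and> m - n < j then e (i + n) (j + n) else 0)"
    using 1 pq ij by (simp add: nprod_sum_right sum.distrib)
  have 2: "nprod V (e p q) (int s) (?f u) = 0" if "u \<in> {m-n<..m}" "2 \<le> s" for u
    using that pq ij mn by (auto simp: simps)
  then show "2 \<le> s \<Longrightarrow> nprod V (e p q) (int s) (hats i j) = 0"
    by (simp add: nprod_sum_right)
qed

text \<open>Both factors lie in the first block, so double contractions survive. For
  \<open>p = j\<close> the bracket leaves \<open>e u q\<close> against \<open>e i u\<close>: its
  product of index 0 yields \<open>e i q\<close> for each \<open>u\<close>, hence the factor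
  \<open>m - n\<close>, and the trace if \<open>q = i\<close>; its product of index 1 yields
  \<open>m - n\<close> copies of \<alpha>1.\<close>

lemma nprod_e_lows:
  "nprod V (e p q) 0 (lows i j) =
    (if q = i then lows p j else 0) - (if p \<le> m - n then nprod V (e p j) (-1) (e i q) else 0)
    + (if q \<le> m - n then nprod V (e p j) (-1) (e i q) else 0) - (if p = j then lows i q else 0)"
  "nprod V (e p q) 1 (lows i j) =
    (if q = i \<and> p \<le> m - n then vscale V \<alpha>1 (e p j) else 0)
    + (if q \<le> m - n \<and> i = j then e p q else 0) - (if p = q \<and> q \<le> m - n then e i j else 0)
    - (if p = j \<and> q = i then \<Sum>u\<in>{1..m-n}. e u u else 0)
    + (if p = j then vscale V (of_nat (m - n)) (e i q) else 0)
    + (if p = j \<and> q \<le> m - n then vscale V \<alpha>1 (e i q) else 0)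
    + (if p = q \<and> j \<le> m - n then e i j else 0)"
  "nprod V (e p q) 2 (lows i j) =
    (if p = q \<and> q \<le> m - n \<and> i = j then vscale V \<alpha>1 (vac V) else 0)
    - (if p = j \<and> q = i then vscale V (of_nat (m - n) * \<alpha>1) (vac V) else 0)"
  "3 \<le> s \<Longrightarrow> nprod V (e p q) (int s) (lows i j) = 0"
proof -
  let ?f = "\<lambda>u. nprod V (e u j) (-1) (e i u)"
  note simps = nprod_e_normally_ordered nprod_e_e E_in_b_basis_iff
  have 0: "nprod V (e p q) 0 (?f u) =
      (if q = i then nprod V (e u j) (-1) (e p u) else 0)
      - (if p = u then nprod V (e p j) (-1) (e i q) else 0)
      + (if q = u then nprod V (e p j) (-1) (e i q) else 0)
      - (if p = j then nprod V (e u q) (-1) (e i u) else 0)" if "u \<in> {1..m-n}" for u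
    using that pq ij mn by (auto simp: simps nprod_diff_right)
  show "nprod V (e p q) 0 (lows i j) =
    (if q = i then lows p j else 0) - (if p \<le> m - n then nprod V (e p j) (-1) (e i q) else 0)
    + (if q \<le> m - n then nprod V (e p j) (-1) (e i q) else 0) - (if p = j then lows i q else 0)"
    using 0 pq by (simp add: nprod_sum_right sum_subtractf sum.distrib)
  have 1: "nprod V (e p q) 1 (?f u) =
      (if p = u then if q = i then vscale V \<alpha>1 (e p j) else 0 else 0)
      + (if q = u then if i = j then e p q else 0 else 0)
      - (if q = u then if p = q then e i j else 0 else 0)
      - (if p = j \<and> q = i then e u u else 0)
      + (if p = j then e i q else 0)
      + (if q = u then if p = j then vscale V \<alpha>1 (e i q) else 0 else 0)
      + (if j = u then if p = q then e i j else 0 else 0)" if u: "u \<in> {1..m-n}" for u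
  proof -
    have b: "E p q \<in> b_basis m n" "E u j \<in> b_basis m n" "E i u \<in> b_basis m n"
        "E p j \<in> b_basis m n" "E u q \<in> b_basis m n"
      using u pq ij mn by (auto simp: E_in_b_basis_iff)
    \<comment> \<open>The second summand of the form drops because
      \<open>u <= m - n < i\<close>.\<close>
    have "\<kappa> p q i u = \<alpha>1 * of_bool (p = u \<and> i = q)" "u \<noteq> i"
      using u pq ij by (auto simp: a_form_first_block simp del: a_form.simps)
    moreover have "\<kappa> p q u j = \<alpha>1 * of_bool (p = j \<and> u = q) + of_bool (p = q \<and> u = j)"
      using u pq ij by (intro a_form_first_block) auto
    ultimately show ?thesis
      using b by (auto simp: nprod_e_normally_ordered nprod_e_e nprod_scale_right creation scale_left_distrib simp del: a_form.simps)
  qed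
  show "nprod V (e p q) 1 (lows i j) =
    (if q = i \<and> p \<le> m - n then vscale V \<alpha>1 (e p j) else 0)
    + (if q \<le> m - n \<and> i = j then e p q else 0) - (if p = q \<and> q \<le> m - n then e i j else 0)
    - (if p = j \<and> q = i then \<Sum>u\<in>{1..m-n}. e u u else 0)
    + (if p = j then vscale V (of_nat (m - n)) (e i q) else 0)
    + (if p = j \<and> q \<le> m - n then vscale V \<alpha>1 (e i q) else 0)
    + (if p = q \<and> j \<le> m - n then e i j else 0)"
    using 1 pq ij by (simp add: nprod_sum_right sum_subtractf sum.distrib sum_constant_scale)
  have 2: "nprod V (e p q) 2 (?f u) =
      (if q = u then if p = q \<and> i = j then vscale V \<alpha>1 (vac V) else 0 else 0)
      - (if p = j \<and> q = i then vscale V \<alpha>1 (vac V) else 0)" if u: "u \<in> {1..m-n}" for u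
  proof -
    have b: "E p q \<in> b_basis m n" "E u j \<in> b_basis m n" "E i u \<in> b_basis m n"
        "E p j \<in> b_basis m n" "E u q \<in> b_basis m n"
      using u pq ij mn by (auto simp: E_in_b_basis_iff)
    have "\<kappa> p j i u = \<alpha>1 * of_bool (p = u \<and> i = j)" "\<kappa> u q i u = \<alpha>1 * of_bool (q = i)" "u \<noteq> i"
      using u pq ij by (auto simp: a_form_first_block simp del: a_form.simps)
    then show ?thesis
      using b nprod_e_normally_ordered(3)[OF b(1,2), of 2 i u] by (auto simp: nprod_e_e simp del: a_form.simps)
  qed
  show "nprod V (e p q) 2 (lows i j) =
    (if p = q \<and> q \<le> m - n \<and> i = j then vscale V \<alpha>1 (vac V) else 0)
    - (if p = j \<and> q = i then vscale V (of_nat (m - n) * \<alpha>1) (vac V) else 0)"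
    using 2 pq ij by (simp add: nprod_sum_right sum_subtractf sum_constant_scale)
  have 3: "nprod V (e p q) (int s) (?f u) = 0" if "u \<in> {1..m-n}" "3 \<le> s" for u
    using that pq ij mn by (auto simp: simps)
  then show "3 \<le> s \<Longrightarrow> nprod V (e p q) (int s) (lows i j) = 0"
    by (simp add: nprod_sum_right)
qed

end

text \<open>Here the roles are reversed: \<open>e u j\<close> commutes with the hatted current, and
  the second factor contributes, now with the form of the second block.\<close>

lemma nprod_hat_e_hats:
  assumes "p \<in> {m-n<..m}" "q \<in> {m-n<..m}" "i \<in> {m-n<..m}" "j \<in> {1..m}"
  shows "nprod V (e (p + n) (q + n)) 0 (hats i j) =
    (if q = i then hats p j else 0) - nprod V (e p j) (-1) (e (i + n) (q + n))"
  and "nprod V (e (p + n) (q + n)) 1 (hats i j) =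
    (if q = i then vscale V \<alpha>2 (e p j) else 0) + (if p = q then e i j else 0)"
  and "2 \<le> s \<Longrightarrow> nprod V (e (p + n) (q + n)) (int s) (hats i j) = 0"
proof -
  note bounds = less_diff_conv2[OF mn(2)]
  let ?f = "\<lambda>u. nprod V (e u j) (-1) (e (i + n) (u + n))"
  have b: "E (p + n) (q + n) \<in> b_basis m n" "E u j \<in> b_basis m n"
      "E (i + n) (u + n) \<in> b_basis m n" "\<kappa> (p + n) (q + n) u j = 0"
      "q + n \<noteq> u" "p + n \<noteq> j" if "u \<in> {m-n<..m}" for u
    using that assms mn by (auto simp: E_in_b_basis_iff bounds a_form_mixed_cols simp del: a_form.simps)
  have 0: "nprod V (e (p + n) (q + n)) 0 (?f u) =
      (if q = i then nprod V (e u j) (-1) (e (p + n) (u + n)) else 0)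
      - (if p = u then nprod V (e p j) (-1) (e (i + n) (q + n)) else 0)" if "u \<in> {m-n<..m}" for u
    using b[OF that] by (auto simp: nprod_e_normally_ordered nprod_e_e nprod_diff_right simp del: a_form.simps)
  show "nprod V (e (p + n) (q + n)) 0 (hats i j) =
    (if q = i then hats p j else 0) - nprod V (e p j) (-1) (e (i + n) (q + n))"
    using 0 assms by (simp add: nprod_sum_right sum_subtractf)
  have 1: "nprod V (e (p + n) (q + n)) 1 (?f u) =
      (if p = u then if q = i then vscale V \<alpha>2 (e u j) else 0 else 0)
      + (if i = u then if p = q then e u j else 0 else 0)" if u: "u \<in> {m-n<..m}" for u
  proof -
    have "\<kappa> (p + n) (q + n) (i + n) (u + n) = \<alpha>2 * of_bool (p = u \<and> i = q) + of_bool (p = q \<and> i = u)"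
      using u assms by (intro a_form_second_block)
    then show ?thesis using b[OF u]
      by (auto simp: nprod_e_normally_ordered nprod_e_e nprod_add_right nprod_scale_right creation scale_left_distrib
          simp del: a_form.simps)
  qed
  show "nprod V (e (p + n) (q + n)) 1 (hats i j) =
    (if q = i then vscale V \<alpha>2 (e p j) else 0) + (if p = q then e i j else 0)"
    using 1 assms by (simp add: nprod_sum_right sum.distrib)
  have 2: "nprod V (e (p + n) (q + n)) (int s) (?f u) = 0" if "2 \<le> s" "u \<in> {m-n<..m}" for u
    using b[OF that(2)] that(1) by (auto simp: nprod_e_normally_ordered nprod_e_e simp del: a_form.simps)
  then show "2 \<le> s \<Longrightarrow> nprod V (e (p + n) (q + n)) (int s) (hats i j) = 0"
    by (simp add: nprod_sum_right)
qed

text \<open>Both factors of every summand lie in the first block, where a hatted current has zero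
  brackets and zero form.\<close>

lemma nprod_hat_e_lows:
  assumes "p \<in> {m-n<..m}" "q \<in> {m-n<..m}" "i \<in> {m-n<..m}" "j \<in> {1..m}"
  shows "nprod V (e (p + n) (q + n)) (int s) (lows i j) = 0"
proof -
  note bounds = less_diff_conv2[OF mn(2)]
  have z: "nprod V (e (p + n) (q + n)) (int s) (nprod V (e u j) (-1) (e i u)) = 0"
    if "u \<in> {1..m-n}" for u
  proof -
    have b: "E (p + n) (q + n) \<in> b_basis m n" "E u j \<in> b_basis m n" "E i u \<in> b_basis m n"
      "\<kappa> (p + n) (q + n) u j = 0" "\<kappa> (p + n) (q + n) i u = 0"
      "q + n \<noteq> u" "p + n \<noteq> j" "q + n \<noteq> i" "p + n \<noteq> u"
      using that assms mn by (auto simp: E_in_b_basis_iff bounds a_form_mixed_cols simp del: a_form.simps)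
    have "s = 0 \<or> s = 1 \<or> 2 \<le> s" by linarith
    then show ?thesis
      using b by (auto simp: nprod_e_normally_ordered nprod_e_e simp del: a_form.simps)
  qed
  then show ?thesis by (simp add: nprod_sum_right)
qed

section \<open>Products of a single current with \<open>W2_elt\<close>\<close>

lemma W2_elt_expand:
  assumes "i \<in> {m-n<..m}" "j \<in> {1..m}"
  shows "W2_elt m n \<alpha>2 V J i j = e (i + n) j - vscale V \<alpha>2 (de i j) + hats i j - lows i j"
proof -
  have b: "E i j \<in> b_basis m n" using assms mn by (auto simp: E_in_b_basis_iff)
  then have "E i j \<in> a_basis m n" by (simp add: a_basis_def)
  \<comment> \<open>The \<open>[-2]\<close> term becomes a mode of \<open>e i j\<close> on the
    vacuum, the shape treated in \<open>nprod_e_e_minus_2\<close>.\<close>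
  then show ?thesis unfolding W2_elt_def by (simp add: e_eq_current[OF b]) (simp add: g_vec_def)
qed

lemma nprod_W2_elt:
  assumes "i \<in> {m-n<..m}" "j \<in> {1..m}" "x \<in> vspace V"
  shows "nprod V x s (W2_elt m n \<alpha>2 V J i j) =
    nprod V x s (e (i + n) j) - vscale V \<alpha>2 (nprod V x s (de i j))
    + nprod V x s (hats i j) - nprod V x s (lows i j)"
  using assms(3) unfolding W2_elt_expand[OF assms(1,2)]
  by (simp add: nprod_add_right nprod_diff_right nprod_scale_right vspace_intros)

context
  fixes p q i j :: nat
  assumes ij: "i \<in> {m-n<..m}" "j \<in> {1..m}"
begin

text \<open>In index 0 the terms with \<open>p = j\<close> reassemble into \<open>W2_elt\<close>. In
  index 1 the terms \<open>de\<close> and \<open>lows\<close> give \<open>e i q\<close> the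
  coefficient \<open>\<alpha>2 - (m - n) = \<alpha>1\<close>, which a further
  \<open>- \<alpha>1\<close> removes if \<open>q <= m - n\<close>. In index 2 they give \<open>- 2
  \<alpha>2 \<alpha>1 + (m - n) \<alpha>1 = - (\<alpha>1 + \<alpha>2) \<alpha>1\<close>.\<close>

lemma nprod_e_W2_elt:
  assumes pq: "p \<in> {1..m}" "q \<in> {1..m}" and \<alpha>: "\<alpha>2 = \<alpha>1 + of_nat (m - n)"
  shows "nprod V (e p q) 0 (W2_elt m n \<alpha>2 V J i j) =
    - (if p = j then W2_elt m n \<alpha>2 V J i q else 0)
    - (if q = i then vscale V \<alpha>2 (de p j) + lows p j else 0)
    + (if m - n < q then nprod V (e p j) (-1) (e (i + n) (q + n)) else 0)
    + (if p \<le> m - n then nprod V (e p j) (-1) (e i q) else 0)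
    - (if q \<le> m - n then nprod V (e p j) (-1) (e i q) else 0)"
  and "nprod V (e p q) 1 (W2_elt m n \<alpha>2 V J i j) =
    (if p = j \<and> m - n < q then vscale V \<alpha>1 (e i q + e (i + n) (q + n)) else 0)
    + (if p = q \<and> m - n < j then e (i + n) (j + n) else 0)
    + (if p = q \<and> q \<le> m - n then e i j else 0)
    - (if p = q \<and> j \<le> m - n then e i j else 0)
    - (if q = i then vscale V \<alpha>2 (e p j) else 0)
    - (if q = i \<and> p \<le> m - n then vscale V \<alpha>1 (e p j) else 0)
    - (if q \<le> m - n \<and> i = j then e p q else 0)
    + (if p = j \<and> q = i then \<Sum>u\<in>{1..m-n}. e u u else 0)"
  and "nprod V (e p q) 2 (W2_elt m n \<alpha>2 V J i j) =
    - vscale V (of_bool (q = i \<and> p = j) * (\<alpha>1 + \<alpha>2) * \<alpha>1) (vac V)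
    - vscale V (of_bool (p = q \<and> i = j) * (of_bool (q \<le> m - n) * \<alpha>1 + 2 * \<alpha>2)) (vac V)"
  and "3 \<le> s \<Longrightarrow> nprod V (e p q) (int s) (W2_elt m n \<alpha>2 V J i j) = 0"
proof -
  have b: "E p q \<in> b_basis m n" "E i j \<in> b_basis m n" "E (i + n) j \<in> b_basis m n"
      "q \<noteq> i + n" "i \<in> {1..m}" "i + n \<in> {1..m+n}" "j \<in> {1..m+n}"
    using pq ij mn by (auto simp: E_in_b_basis_iff)
  have \<kappa>: "\<kappa> p q i j = \<alpha>1 * of_bool (p = j \<and> i = q) + of_bool (p = q \<and> i = j)"
    using pq ij b by (intro a_form_first_block)
  note nprod_W2 = nprod_W2_elt[OF ij e_space]
  note hats = nprod_e_hats[OF pq ij] and lows = nprod_e_lows[OF pq ij]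
  note mixed = nprod_e_e_mixed_cols[OF pq ij(1) b(7)]
  show "nprod V (e p q) 0 (W2_elt m n \<alpha>2 V J i j) =
    - (if p = j then W2_elt m n \<alpha>2 V J i q else 0)
    - (if q = i then vscale V \<alpha>2 (de p j) + lows p j else 0)
    + (if m - n < q then nprod V (e p j) (-1) (e (i + n) (q + n)) else 0)
    + (if p \<le> m - n then nprod V (e p j) (-1) (e i q) else 0)
    - (if q \<le> m - n then nprod V (e p j) (-1) (e i q) else 0)"
    unfolding nprod_W2 hats lows nprod_e_e_minus_2[OF b(1,2)] nprod_e_e[OF b(1,3)] W2_elt_expand[OF ij(1) pq(2)]
    using b(4) by (simp add: scale_right_diff_distrib algebra_simps)
  show "nprod V (e p q) 1 (W2_elt m n \<alpha>2 V J i j) =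
    (if p = j \<and> m - n < q then vscale V \<alpha>1 (e i q + e (i + n) (q + n)) else 0)
    + (if p = q \<and> m - n < j then e (i + n) (j + n) else 0)
    + (if p = q \<and> q \<le> m - n then e i j else 0)
    - (if p = q \<and> j \<le> m - n then e i j else 0)
    - (if q = i then vscale V \<alpha>2 (e p j) else 0)
    - (if q = i \<and> p \<le> m - n then vscale V \<alpha>1 (e p j) else 0)
    - (if q \<le> m - n \<and> i = j then e p q else 0)
    + (if p = j \<and> q = i then \<Sum>u\<in>{1..m-n}. e u u else 0)"
    unfolding nprod_W2 hats lows nprod_e_e_minus_2[OF b(1,2)] mixed[of 1, simplified]
    by (cases "p = j"; cases "q = i"; cases "p = q"; cases "q \<le> m - n"; cases "j \<le> m - n")
      (simp_all add: scale_right_diff_distrib scale_right_distrib scale_left_distrib \<alpha> algebra_simps)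
  show "nprod V (e p q) 2 (W2_elt m n \<alpha>2 V J i j) =
    - vscale V (of_bool (q = i \<and> p = j) * (\<alpha>1 + \<alpha>2) * \<alpha>1) (vac V)
    - vscale V (of_bool (p = q \<and> i = j) * (of_bool (q \<le> m - n) * \<alpha>1 + 2 * \<alpha>2)) (vac V)"
    using nprod_e_hats(3)[OF pq ij, of 2]
    unfolding nprod_W2 lows nprod_e_e_minus_2[OF b(1,2)] mixed[of 2, simplified] \<kappa>
    by (cases "p = j"; cases "q = i"; cases "p = q"; cases "q \<le> m - n")
      (simp_all add: \<alpha> distrib_left distrib_right
        flip: scale_left_distrib scale_left_diff_distrib scale_minus_left)
  show "3 \<le> s \<Longrightarrow> nprod V (e p q) (int s) (W2_elt m n \<alpha>2 V J i j) = 0"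
    unfolding nprod_W2 using mixed[of "int s"] hats(3) lows(4) nprod_e_e_minus_2(4)[OF b(1,2)] by simp
qed

text \<open>Only \<open>e (i + n) j\<close>, through its left index, and \<open>hats\<close> can
  contribute; \<open>de\<close> and \<open>lows\<close> are built from first-block currents.\<close>

lemma nprod_hat_e_W2_elt:
  assumes pq: "p \<in> {m-n<..m}" "q \<in> {m-n<..m}"
  shows "nprod V (e (p + n) (q + n)) 0 (W2_elt m n \<alpha>2 V J i j) =
    (if q = i then e (p + n) j + hats p j else 0) - nprod V (e p j) (-1) (e (i + n) (q + n))"
  and "nprod V (e (p + n) (q + n)) 1 (W2_elt m n \<alpha>2 V J i j) =
    (if q = i then vscale V \<alpha>2 (e p j) else 0) + (if p = q then e i j else 0)"
  and "2 \<le> s \<Longrightarrow> nprod V (e (p + n) (q + n)) (int s) (W2_elt m n \<alpha>2 V J i j) = 0"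
proof -
  have b: "E (p + n) (q + n) \<in> b_basis m n" "E i j \<in> b_basis m n" "E (i + n) j \<in> b_basis m n"
      "q + n \<noteq> i" "p + n \<noteq> j" "\<kappa> (p + n) (q + n) i j = 0" "\<kappa> (p + n) (q + n) (i + n) j = 0"
    using pq ij mn
    by (auto simp: E_in_b_basis_iff less_diff_conv2 a_form_mixed_cols simp del: a_form.simps)
  have de: "nprod V (e (p + n) (q + n)) (int t) (de i j) = 0" for t
  proof -
    have "t = 0 \<or> t = 1 \<or> t = 2 \<or> 3 \<le> t" by linarith
    then show ?thesis using nprod_e_e_minus_2[OF b(1,2)] b(4-6) by auto
  qed
  note nprod_W2 = nprod_W2_elt[OF ij e_space]
  note hats = nprod_hat_e_hats[OF pq ij] and lows = nprod_hat_e_lows[OF pq ij]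
  show "nprod V (e (p + n) (q + n)) 0 (W2_elt m n \<alpha>2 V J i j) =
    (if q = i then e (p + n) j + hats p j else 0) - nprod V (e p j) (-1) (e (i + n) (q + n))"
    unfolding nprod_W2 hats nprod_e_e[OF b(1,3)]
    using de[of 0] lows[of 0] b(5) by (simp add: algebra_simps)
  show "nprod V (e (p + n) (q + n)) 1 (W2_elt m n \<alpha>2 V J i j) =
    (if q = i then vscale V \<alpha>2 (e p j) else 0) + (if p = q then e i j else 0)"
    unfolding nprod_W2 hats nprod_e_e[OF b(1,3)]
    using de[of 1] lows[of 1] b(7) by (simp add: algebra_simps)
  show "2 \<le> s \<Longrightarrow> nprod V (e (p + n) (q + n)) (int s) (W2_elt m n \<alpha>2 V J i j) = 0"
    unfolding nprod_W2 using de lows hats(3) nprod_e_e(3)[OF b(1,3), of "int s"] by simp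
qed

end

end

section \<open>Assembly of the products with \<open>W1\<close> from those of its one or two
  currents\<close>

theorem theorem4p6:
  fixes m n p q i j :: nat and k \<alpha>1 \<alpha>2 :: complex
    and V W :: "'v::ab_group_add vsalg" and J :: "gen \<Rightarrow> 'v" and d :: "'v \<Rightarrow> 'v"
    and W1 W2 :: "nat \<Rightarrow> nat \<Rightarrow> 'v"
  assumes "1 \<le> n" and "n \<le> m"
    and "\<alpha>1 = k + of_nat n" and "\<alpha>2 = k + of_nat m"
    and "universal_affine V (a_lsalg m n \<alpha>1 \<alpha>2) J"
    and "is_d0 m n \<alpha>2 V J d"
    and "W = W_algebra m n V J d"
    and "W1 = W1_elt m n V J"
    and "W2 = W2_elt m n \<alpha>2 V J"
    and "(1 \<le> p \<and> p \<le> m - n \<and> 1 \<le> q \<and> q \<le> m) \<or> (m - n < p \<and> p \<le> m \<and> m - n < q \<and> q \<le> m)"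
    and "m - n < i" and "i \<le> m" and "1 \<le> j" and "j \<le> m"
  shows
    "(nprod W (W1 p q) 0 (W2 i j) =
       - vscale W (of_bool (p = j)) (W2 i q)
       + vscale W (of_bool (i = q) * of_bool (p > m - n)) (W2 p j)
       - vscale W (of_bool (i = q) * of_bool (p \<le> m - n))
           (\<Sum>w\<in>{1..m-n}. nprod W (W1 w j) (-1) (W1 p w))
       - vscale W (of_bool (i = q) * of_bool (p \<le> m - n) * \<alpha>2) (transl W (W1 p j))
       + vscale W (of_bool (p \<le> m - n \<and> q > m - n)) (nprod W (W1 p j) (-1) (W1 i q)))
     \<and> (nprod W (W1 p q) 1 (W2 i j) =
       vscale W (of_bool (p = j) * \<alpha>1 * of_bool (q > m - n)) (W1 i q)
       - vscale W (of_bool (i = q) * of_bool (p \<le> m - n) * (\<alpha>2 + \<alpha>1)) (W1 p j)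
       + vscale W (of_bool (p = q) * of_bool (j > m - n)) (W1 i j)
       - vscale W (of_bool (i = j) * of_bool (q \<le> m - n)) (W1 p q)
       + vscale W (of_bool (p = j) * of_bool (q = i)) (\<Sum>w\<in>{1..m-n}. W1 w w))
     \<and> (nprod W (W1 p q) 2 (W2 i j) =
       - vscale W (of_bool (q = i) * of_bool (p = j) * (\<alpha>1 + \<alpha>2) * \<alpha>1) (vac W)
       - vscale W (of_bool (p = q) * of_bool (i = j) *
           (of_bool (p \<le> m - n \<and> q \<le> m - n) * \<alpha>1 + 2 * \<alpha>2)) (vac W))
     \<and> (\<forall>s>2. nprod W (W1 p q) s (W2 i j) = 0)"
proof -
  note mn = assms(1,2) and V = assms(5)
  interpret universal_affine V "a_lsalg m n \<alpha>1 \<alpha>2" J by (rule V)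
  let ?e = "\<lambda>a b. g_vec m n V J (E a b) (-1)"
  \<comment> \<open>The subalgebra inherits all operations, so everything can be computed in
    \<open>V\<close>.\<close>
  have W: "nprod W = nprod V" "vscale W = vscale V" "vac W = vac V" "transl W = transl V"
    by (simp_all add: assms(7) W_algebra_def Vb_def sub_vsalg_def)
  have \<alpha>: "\<alpha>2 = \<alpha>1 + of_nat (m - n)" using assms(2-4) by (simp add: of_nat_diff)
  have pq: "p \<in> {1..m}" "q \<in> {1..m}" and ij: "i \<in> {m-n<..m}" "j \<in> {1..m}"
    using assms(10-14) by auto
  note e_space = e_space[OF mn V]
  have low: "W1 a b = ?e a b" if "1 \<le> a" "a \<le> m - n" "1 \<le> b" "b \<le> m" for a b
    using W1_sum[OF mn V assms(6), of a b] that by (simp add: assms(8))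
  have high: "W1 a b = ?e a b + ?e (a + n) (b + n)" if "m - n < a" "a \<le> m" "m - n < b" "b \<le> m" for a b
    using W1_sum[OF mn V assms(6), of a b] that by (simp add: assms(8))
  note first = nprod_e_W2_elt[OF mn V ij pq \<alpha>, folded assms(9)]
  note W2 = W2_elt_expand[OF mn V, folded assms(9)]
  have W2_space: "W2 i j \<in> vspace V"
    unfolding W2[OF ij] by (intro vspace_intros nprod_space e_space)
  show ?thesis
  proof (cases "p \<le> m - n")
    case True
    have "W1 p q = ?e p q" "W1 p j = ?e p j" using True pq ij by (simp_all add: low)
    moreover have "W1 i q = ?e i q + ?e (i + n) (q + n)" if "m - n < q"
      using that ij pq by (simp add: high)
    moreover have "W1 i j = ?e i j + ?e (i + n) (j + n)" if "m - n < j"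
      using that ij by (simp add: high)
    moreover have "(\<Sum>w\<in>{1..m-n}. nprod V (W1 w j) (-1) (W1 p w)) =
        (\<Sum>w\<in>{1..m-n}. nprod V (?e w j) (-1) (?e p w))"
      using True pq ij by (intro sum.cong) (auto simp: low)
    moreover have "(\<Sum>w\<in>{1..m-n}. W1 w w) = (\<Sum>w\<in>{1..m-n}. ?e w w)"
      by (intro sum.cong) (auto simp: low)
    moreover have "nprod V (?e p q) s (W2 i j) = 0" if "2 < s" for s
      using first(4)[of "nat s"] that by simp
    \<comment> \<open>In index 0 the products with \<open>e p j\<close> on the left add up to the
      product of \<open>W1 p j\<close> and \<open>W1 i q\<close> if \<open>q > m - n\<close> and
      cancel otherwise; \<open>de p j\<close> is the translate of \<open>W1 p j\<close>, and
      \<open>lows p j\<close> is the quadratic sum.\<close>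
    ultimately show ?thesis
      using first(1-3) True unfolding W translation[OF e_space]
      by (auto simp: translation e_space nprod_add_right of_bool_def scale_left_distrib)
  next
    case False
    then have pq': "p \<in> {m-n<..m}" "q \<in> {m-n<..m}" using assms(10) by auto
    note second = nprod_hat_e_W2_elt[OF mn V ij pq', folded assms(9)]
    have W1: "nprod V (W1 p q) s (W2 i j) =
        nprod V (?e p q) s (W2 i j) + nprod V (?e (p + n) (q + n)) s (W2 i j)" for s
      using False pq pq' ij by (simp add: high nprod_add_left W2_space e_space)
    have W1_iq: "W1 i q = ?e i q + ?e (i + n) (q + n)" using pq' ij by (simp add: high)
    have W1_ij: "W1 i j = ?e i j + ?e (i + n) (j + n)" if "m - n < j"
      using that ij by (simp add: high)
    have trace: "(\<Sum>w\<in>{1..m-n}. W1 w w) = (\<Sum>w\<in>{1..m-n}. ?e w w)"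
      by (intro sum.cong) (auto simp: low)
    have ge3: "nprod V (W1 p q) s (W2 i j) = 0" if "2 < s" for s
      unfolding W1 using first(4)[of "nat s"] second(3)[of "nat s"] that by simp
    have "nprod V (?e (p + n) (q + n)) 2 (W2 i j) = 0"
      using second(3)[of 2] by simp
    \<comment> \<open>In index 0, for \<open>q = i\<close>, the two currents supply the two halves
      of \<open>W2 p j\<close>. In index 1 the multiples of \<open>e p j\<close> by \<alpha>2
      cancel, and for \<open>p = q\<close> the hatted current supplies the missing
      \<open>e i j\<close> of \<open>W1 i j\<close>, or cancels \<open>- e i j\<close> if
      \<open>j <= m - n\<close>.\<close>
    then show ?thesis
      using False pq' W1_ij ge3 unfolding W W1 first(1-3) second(1,2) W2[OF pq'(1) ij(2)] W1_iq trace
      by (auto simp: of_bool_def algebra_simps)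
  qed
qed

end
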